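(* Let $n\geq 2$ be an integer, let $c\in\mathbb{R}$, and let $f$ be a real-valued function defined in a neighborhood of $c$. Suppose that (i) $f$ is $n-1$ times Peano differentiable at $c$, and (ii) for every integer $k$ with $0\leq k\leq n-1$, the limit $$\lim_{h\rightarrow 0}\frac 1{h^{n}}\sum_{j=0}^{n}(-1)^{n-j}\binom{n}{j}f(c+(j-k)h)$$ exists (as a finite real number). Then $f$ is $n$ times Peano differentiable at $c$.
   Context: For an integer $m\ge 1$, a real-valued function $f$ defined in a neighborhood of $c$ is said to be $m$ times Peano differentiable at $c$ if there is a polynomial $p$ with real coefficients, of degree at most $m$ and with $p(c)=f(c)$, such that $f(c+h)-p(c+h)=o(h^m)$ as $h\rightarrow 0$. All limits as $h\to 0$ are two-sided. *)

theory Defs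
  imports
    "HOL-Analysis.Analysis"
    "HOL-Library.Landau_Symbols"
    "HOL-Computational_Algebra.Polynomial"
begin

text \<open>
  The notion depends only on the values of \<open>f\<close> near \<open>c\<close>, so a function that is defined merely
  in a neighbourhood of \<open>c\<close> is represented by an arbitrary total extension.
  It is meant for \<open>m \<ge> 1\<close>. The filter \<open>at 0\<close> is the punctured two-sided neighbourhood filter.
\<close>

definition peano_differentiable :: "nat \<Rightarrow> (real \<Rightarrow> real) \<Rightarrow> real \<Rightarrow> bool" where
  "peano_differentiable m f c \<longleftrightarrow>
     (\<exists>p :: real poly. degree p \<le> m \<and> poly p c = f c \<and>
        (\<lambda>h. f (c + h) - poly p (c + h)) \<in> o[at 0](\<lambda>h. h ^ m))"

end

theory Submission
  imports Defs
begin

text \<open>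
  Subtracting a polynomial of degree less than \<open>n\<close>, we may assume \<open>c = 0\<close> and
  \<open>f(h) = o(h\<^sup>n\<^sup>-\<^sup>1)\<close>. Work modulo the functions \<open>g\<close> for which \<open>g(h) / h\<^sup>n\<close> converges as
  \<open>h \<rightarrow> 0\<close>. By (ii) the \<open>n\<close>-th differences of \<open>i \<mapsto> f(ih)\<close>
  within the integers \<open>1 - n \<le> i \<le> n\<close> all vanish, so on this range \<open>f(ih) = \<Sum>\<^sub>d i\<^sup>d a\<^sub>d(h)\<close> with \<open>d < n\<close>.
  There are \<open>n\<close> integers \<open>j\<close> such that \<open>2j\<close> is in the range as well;
  comparing \<open>f(2j \<cdot> h)\<close> with \<open>f(j \<cdot> 2h)\<close> at these \<open>j\<close> gives \<open>a\<^sub>d(2h) = 2\<^sup>d a\<^sub>d(h)\<close>.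
  Since \<open>d < n\<close> and \<open>a\<^sub>d(h) = o(h\<^sup>n\<^sup>-\<^sup>1)\<close>, iterating \<open>a\<^sub>d(h) = 2\<^sup>d a\<^sub>d(h/2)\<close> shows that
  \<open>a\<^sub>d\<close> vanishes, hence so does \<open>f(h) = \<Sum>\<^sub>d a\<^sub>d(h)\<close>.
\<close>

section \<open>Functions whose quotient by \<open>h ^ n\<close> converges\<close>

definition has_order_limit :: "nat \<Rightarrow> (real \<Rightarrow> real) \<Rightarrow> bool" where
  "has_order_limit n g \<longleftrightarrow> (\<exists>L. ((\<lambda>h. g h / h ^ n) \<longlongrightarrow> L) (at 0))"

lemma has_order_limit_zero: "has_order_limit n (\<lambda>h. 0)"
  by (auto simp: has_order_limit_def)

lemma has_order_limit_add:
  assumes "has_order_limit n g" "has_order_limit n h"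
  shows "has_order_limit n (\<lambda>x. g x + h x)"
  using assms unfolding has_order_limit_def add_divide_distrib by (metis (no_types) tendsto_add)

lemma has_order_limit_cmult:
  assumes "has_order_limit n g"
  shows "has_order_limit n (\<lambda>x. a * g x)"
  using assms unfolding has_order_limit_def times_divide_eq_right[symmetric]
  by (metis (no_types) tendsto_mult_left)

lemma has_order_limit_diff:
  assumes "has_order_limit n g" "has_order_limit n h"
  shows "has_order_limit n (\<lambda>x. g x - h x)"
  using assms unfolding has_order_limit_def diff_divide_distrib by (metis (no_types) tendsto_diff)

lemma has_order_limit_sum:
  assumes "\<And>i. i \<in> A \<Longrightarrow> has_order_limit n (g i)"
  shows "has_order_limit n (\<lambda>x. \<Sum>i\<in>A. g i x)"
  using assms
  by (induction A rule: infinite_finite_induct)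
     (simp_all add: has_order_limit_zero has_order_limit_add)

section \<open>Finite differences of polynomials and Lagrange interpolation\<close>

text \<open>By Pascal's rule, the difference of order \<open>Suc n\<close> of \<open>p\<close> is
  the difference of order \<open>n\<close> of p(x + 1) - p(x), in which the leading terms
  cancel.\<close>

lemma nth_difference_poly_eq_0:
  fixes p :: "'a::idom poly"
  assumes "degree p < n"
  shows "(\<Sum>j=0..n. (-1) ^ (n - j) * of_nat (n choose j) * poly p (x + of_nat j)) = 0"
  using assms
proof (induction n arbitrary: p x)
  case (Suc n)
  define q where "q = pcompose p [:1, 1:] - p"
  \<comment> \<open>For constant \<open>p\<close> the degree cannot drop, as the zero polynomial has
    degree 0. Hence \<open>q = 0\<close> is a separate case, and for \<open>n = 0\<close> the only
    one.\<close>
  have deg: "q = 0 \<or> degree q < n"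
  proof (cases "degree p = 0")
    case True
    then obtain a where "p = [:a:]" by (metis degree_eq_zeroE)
    then show ?thesis by (simp add: q_def)
  next
    case False
    have c: "coeff (pcompose p [:1, 1:]) (degree p) = lead_coeff p"
      using lead_coeff_comp[of "[:1, 1:]" p] degree_pcompose[of p "[:1, 1:]"] by simp
    have "degree q \<le> degree p"
      using degree_diff_le[of "pcompose p [:1, 1:]" "degree p" p] degree_pcompose[of p "[:1, 1:]"]
      by (simp add: q_def)
    moreover have "coeff q (degree p) = 0" using c by (simp add: q_def)
    ultimately have "q = 0 \<or> degree q < degree p"
      using eq_zero_or_degree_less by blast
    then show ?thesis using Suc.prems by auto
  qed
  have "(\<Sum>j=0..Suc n. (-1) ^ (Suc n - j) * of_nat (Suc n choose j) * poly p (x + of_nat j))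
      = (\<Sum>j\<le>Suc n. (-1) ^ (Suc n - j) * of_nat (Suc n choose j) * poly p (x + of_nat j))"
    by (simp add: atMost_atLeast0)
  also have "\<dots> = (-1) ^ Suc n * poly p x
      + (\<Sum>j\<le>n. (-1) ^ (n - j) * of_nat ((n choose j) + (n choose Suc j)) * poly p (x + 1 + of_nat j))"
    by (simp only: sum.atMost_Suc_shift) (simp add: algebra_simps)
  also have "\<dots> = (\<Sum>j\<le>n. (-1) ^ (n - j) * of_nat (n choose j) * poly p (x + 1 + of_nat j))
      + ((-1) ^ Suc n * poly p x
      + (\<Sum>j\<le>n. (-1) ^ (n - j) * of_nat (n choose Suc j) * poly p (x + 1 + of_nat j)))"
    by (simp add: algebra_simps sum.distrib)
  \<comment> \<open>The split-off term is the one with index 0, so the index shift can be undone.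
    The index \<open>Suc n\<close> contributes nothing, and the sign exponent is one too high, which
    produces the minus sign of the next step.\<close>
  also have "(-1) ^ Suc n * poly p x
      + (\<Sum>j\<le>n. (-1) ^ (n - j) * of_nat (n choose Suc j) * poly p (x + 1 + of_nat j))
      = (\<Sum>j\<le>Suc n. (-1) ^ (Suc n - j) * of_nat (n choose j) * poly p (x + of_nat j))"
    by (simp only: sum.atMost_Suc_shift[of _ n]) (simp add: algebra_simps binomial_eq_0)
  also have "\<dots> = - (\<Sum>j\<le>n. (-1) ^ (n - j) * of_nat (n choose j) * poly p (x + of_nat j))"
    by (simp add: sum_negf[symmetric] Suc_diff_le binomial_eq_0)
  also have "(\<Sum>j\<le>n. (-1) ^ (n - j) * of_nat (n choose j) * poly p (x + 1 + of_nat j))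
      + - (\<Sum>j\<le>n. (-1) ^ (n - j) * of_nat (n choose j) * poly p (x + of_nat j))
      = (\<Sum>j=0..n. (-1) ^ (n - j) * of_nat (n choose j) * poly q (x + of_nat j))"
    by (simp add: q_def poly_pcompose atMost_atLeast0 sum_subtractf algebra_simps)
  also have "\<dots> = 0"
    using deg Suc.IH by auto
  finally show ?case .
qed simp

definition lagrange_basis :: "'a::field set \<Rightarrow> 'a \<Rightarrow> 'a poly" where
  "lagrange_basis A a = (\<Prod>b\<in>A - {a}. smult (1 / (a - b)) [:- b, 1:])"

lemma degree_lagrange_basis:
  assumes "finite A" "a \<in> A"
  shows "degree (lagrange_basis A a) < card A"
proof -
  have "degree (lagrange_basis A a) \<le> (\<Sum>b\<in>A - {a}. degree (smult (1 / (a - b)) [:- b, 1:]))"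
    unfolding lagrange_basis_def using assms degree_prod_sum_le[of "A - {a}" "\<lambda>b. smult (1 / (a - b)) [:- b, 1:]"]
    by (simp add: o_def)
  also have "\<dots> \<le> (\<Sum>b\<in>A - {a}. 1)"
    by (intro sum_mono) auto
  also have "\<dots> < card A" using assms
    using card_Diff1_less[of A a] by simp
  finally show ?thesis .
qed

lemma poly_lagrange_basis:
  assumes "finite A" "a \<in> A" "b \<in> A"
  shows "poly (lagrange_basis A a) b = (if a = b then 1 else 0)"
  using assms by (auto simp: lagrange_basis_def poly_prod prod_zero_iff diff_divide_distrib[symmetric] intro!: prod.neutral)

text \<open>Both sides have degree below \<open>card A\<close> and agree on
  \<open>A\<close>.\<close>

lemma lagrange_interpolation:
  assumes "finite A" "degree p < card A"
  shows "(\<Sum>a\<in>A. smult (poly p a) (lagrange_basis A a)) = p"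
proof (rule poly_eqI_degree[of A])
  show "degree (\<Sum>a\<in>A. smult (poly p a) (lagrange_basis A a)) < card A"
    using assms degree_lagrange_basis
    by (intro degree_sum_less) (auto intro: le_less_trans[OF degree_smult_le])
next
  fix x assume "x \<in> A"
  then show "poly (\<Sum>a\<in>A. smult (poly p a) (lagrange_basis A a)) x = poly p x"
    using assms by (simp add: poly_sum poly_lagrange_basis if_distrib[of "\<lambda>x. _ * x"] cong: sum.cong if_cong)
qed (use assms in simp_all)

section \<open>Comparing values at \<open>h\<close> and \<open>2 * h\<close>\<close>

text \<open>Halving the argument repeatedly accumulates errors bounded by a geometric series with
  sum at most \<open>e * \<bar>h\<bar> ^ n\<close>. The remaining term tends to 0 by
  \<open>small\<close>.\<close>

lemma smallo_of_half_scaling: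
  fixes g :: "real \<Rightarrow> real"
  assumes d: "d < n"
    and small: "g \<in> o[at 0](\<lambda>h. h ^ (n - 1))"
    and scaling: "(\<lambda>h. g (2 * h) - 2 ^ d * g h) \<in> o[at 0](\<lambda>h. h ^ n)"
  shows "g \<in> o[at 0](\<lambda>h. h ^ n)"
proof (rule landau_o.smallI)
  fix e :: real
  assume e: "e > 0"
  from landau_o.smallD[OF scaling e] obtain \<delta> where \<delta>: "\<delta> > 0"
    and step: "\<And>h. h \<noteq> 0 \<Longrightarrow> \<bar>h\<bar> < \<delta> \<Longrightarrow> \<bar>g (2 * h) - 2 ^ d * g h\<bar> \<le> e * \<bar>h\<bar> ^ n"
    by (auto simp: eventually_at dist_real_def power_abs)
  have "\<bar>g h\<bar> \<le> e * \<bar>h\<bar> ^ n" if h: "h \<noteq> 0" "\<bar>h\<bar> < \<delta>" for h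
  proof -
    \<comment> \<open>The factor \<open>1 - 1 / 2 ^ N\<close> is the partial sum 1/2 + ... + 1/2^N.
      Each factor \<open>2 ^ d\<close> is enlarged to \<open>2 ^ (n - 1)\<close>, the largest growth
      that \<open>small\<close> can compensate.\<close>
    have iter: "\<bar>g h\<bar> \<le> e * \<bar>h\<bar> ^ n * (1 - 1 / 2 ^ N) + 2 ^ ((n - 1) * N) * \<bar>g (h / 2 ^ N)\<bar>" for N
    proof (induction N)
      case (Suc N)
      let ?y = "h / 2 ^ Suc N"
      have "\<bar>h\<bar> / 2 ^ Suc N \<le> \<bar>h\<bar> / 1"
        by (rule divide_left_mono) (auto simp del: power_Suc)
      then have y: "\<bar>?y\<bar> < \<delta>" using h by simp
      have double: "2 * ?y = h / 2 ^ N" by simp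
      have "\<bar>g (2 * ?y) - 2 ^ d * g ?y\<bar> \<le> e * \<bar>?y\<bar> ^ n"
        using step[of ?y] y h by simp
      then have "\<bar>g (h / 2 ^ N)\<bar> \<le> 2 ^ d * \<bar>g ?y\<bar> + e * \<bar>?y\<bar> ^ n"
        unfolding double using abs_mult[of "2 ^ d" "g ?y"] by simp
      also have "\<dots> \<le> 2 ^ (n - 1) * \<bar>g ?y\<bar> + e * \<bar>?y\<bar> ^ n"
        using d by (intro add_right_mono mult_right_mono power_increasing) auto
      finally have "2 ^ ((n - 1) * N) * \<bar>g (h / 2 ^ N)\<bar>
          \<le> 2 ^ ((n - 1) * N) * (2 ^ (n - 1) * \<bar>g ?y\<bar> + e * \<bar>?y\<bar> ^ n)"
        by (intro mult_left_mono) auto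
      also have "\<dots> = 2 ^ ((n - 1) * Suc N) * \<bar>g ?y\<bar> + e * (2 ^ ((n - 1) * N) * \<bar>?y\<bar> ^ n)"
        by (simp only: mult_Suc_right power_add distrib_left mult.assoc mult.left_commute)
      also have "2 ^ ((n - 1) * N) * \<bar>?y\<bar> ^ n \<le> \<bar>h\<bar> ^ n / 2 ^ Suc N"
      proof -
        have "2 ^ ((n - 1) * N) * \<bar>?y\<bar> ^ n = \<bar>h\<bar> ^ n * (2 ^ ((n - 1) * N) / 2 ^ (n * Suc N))"
          by (simp add: power_divide power_mult[symmetric] mult.commute abs_mult
              del: power_Suc mult_Suc_right mult_Suc)
        also have "\<dots> \<le> \<bar>h\<bar> ^ n * (1 / 2 ^ Suc N)"
        proof (intro mult_left_mono)
          \<comment> \<open>The right side exceeds the left by exactly \<open>n - 1\<close>.\<close>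
          have "(n - 1) * N + Suc N \<le> n * Suc N"
            using d by (cases n) auto
          then have "(2::real) ^ ((n - 1) * N + Suc N) \<le> 2 ^ (n * Suc N)"
            by (rule power_increasing) simp
          then have "(2::real) ^ ((n - 1) * N) * 2 ^ Suc N \<le> 2 ^ (n * Suc N)"
            by (simp only: power_add)
          then show "2 ^ ((n - 1) * N) / 2 ^ (n * Suc N) \<le> (1::real) / 2 ^ Suc N"
            by (simp add: divide_simps del: power_Suc mult_Suc_right mult_Suc)
        qed auto
        finally show ?thesis by simp
      qed
      finally have "2 ^ ((n - 1) * N) * \<bar>g (h / 2 ^ N)\<bar>
          \<le> 2 ^ ((n - 1) * Suc N) * \<bar>g ?y\<bar> + e * (\<bar>h\<bar> ^ n / 2 ^ Suc N)"
        using e by simp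
      with Suc.IH have "\<bar>g h\<bar> \<le> e * \<bar>h\<bar> ^ n * (1 - 1 / 2 ^ N)
          + (2 ^ ((n - 1) * Suc N) * \<bar>g ?y\<bar> + e * (\<bar>h\<bar> ^ n / 2 ^ Suc N))"
        by linarith
      also have "\<dots> = e * \<bar>h\<bar> ^ n * (1 - 1 / 2 ^ Suc N) + 2 ^ ((n - 1) * Suc N) * \<bar>g ?y\<bar>"
        by (simp add: field_simps)
      finally show ?case .
    qed simp
    have y: "filterlim (\<lambda>N. h / 2 ^ N) (at 0) sequentially"
    proof (rule filterlim_atI)
      show "(\<lambda>N. h / 2 ^ N) \<longlonglongrightarrow> 0"
        using LIMSEQ_divide_realpow_zero[of 2 h] by simp
    qed (use h in simp)
    have "((\<lambda>h. g h / h ^ (n - 1)) \<longlongrightarrow> 0) (at 0)"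
      using small by (rule smalloD_tendsto)
    then have "(\<lambda>N. g (h / 2 ^ N) / (h / 2 ^ N) ^ (n - 1)) \<longlonglongrightarrow> 0"
      using y by (rule filterlim_compose)
    \<comment> \<open>Here \<open>h\<close> is fixed and \<open>N\<close> grows. Multiplying by
      \<open>h ^ (n - 1)\<close> turns the quotient into the remainder of
      \<open>iter\<close>.\<close>
    then have "(\<lambda>N. \<bar>h ^ (n - 1) * (g (h / 2 ^ N) / (h / 2 ^ N) ^ (n - 1))\<bar>) \<longlonglongrightarrow> 0"
      by (intro tendsto_rabs_zero tendsto_mult_right_zero)
    also have "(\<lambda>N. \<bar>h ^ (n - 1) * (g (h / 2 ^ N) / (h / 2 ^ N) ^ (n - 1))\<bar>)
        = (\<lambda>N. 2 ^ ((n - 1) * N) * \<bar>g (h / 2 ^ N)\<bar>)"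
      using h by (auto simp: power_divide power_mult[symmetric] mult.commute abs_mult)
    finally have lim: "(\<lambda>N. 2 ^ ((n - 1) * N) * \<bar>g (h / 2 ^ N)\<bar>) \<longlonglongrightarrow> 0" .
    have "(\<lambda>N. e * \<bar>h\<bar> ^ n * (1 - 1 / 2 ^ N) + 2 ^ ((n - 1) * N) * \<bar>g (h / 2 ^ N)\<bar>)
        \<longlonglongrightarrow> e * \<bar>h\<bar> ^ n * (1 - 0) + 0"
      by (intro tendsto_intros lim LIMSEQ_divide_realpow_zero) auto
    then show ?thesis
      using LIMSEQ_le_const[of _ _ "\<bar>g h\<bar>"] iter by auto
  qed
  then show "eventually (\<lambda>h. norm (g h) \<le> e * norm (h ^ n)) (at 0)"
    using \<delta> by (auto simp: eventually_at dist_real_def power_abs)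
qed

lemma has_order_limit_of_half_scaling:
  fixes g :: "real \<Rightarrow> real"
  assumes d: "d < n"
    and small: "g \<in> o[at 0](\<lambda>h. h ^ (n - 1))"
    and scaling: "has_order_limit n (\<lambda>h. g (2 * h) - 2 ^ d * g h)"
  shows "has_order_limit n g"
proof -
  from scaling obtain L where L: "((\<lambda>h. (g (2 * h) - 2 ^ d * g h) / h ^ n) \<longlongrightarrow> L) (at 0)"
    unfolding has_order_limit_def by blast
  define q :: real where "q = 2 ^ n - 2 ^ d"
  have "(2::real) ^ d < 2 ^ n" using d by (intro power_strict_increasing) auto
  then have q: "q \<noteq> 0" by (simp add: q_def)
  \<comment> \<open>Replacing \<open>g\<close> by \<open>g h - A * h ^ n\<close> lowers the scaling
    expression by \<open>A * (2 ^ n - 2 ^ d) * h ^ n\<close>, which is \<open>L * h ^ n\<close> for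
    this \<open>A\<close>. The limit becomes 0 and the previous lemma applies.\<close>
  define A where "A = L / q"
  have nz: "eventually (\<lambda>h::real. h \<noteq> 0) (at 0)"
    by (auto simp: eventually_at intro: exI[of _ 1])
  have "(\<lambda>h. g h - A * h ^ n) \<in> o[at 0](\<lambda>h. h ^ n)"
  proof (rule smallo_of_half_scaling[OF d])
    have "(\<lambda>h::real. h ^ n) \<in> o[at 0](\<lambda>h. h ^ (n - 1))"
    proof (rule smalloI_tendsto)
      have "((\<lambda>h::real. h) \<longlongrightarrow> 0) (at 0)" by (rule tendsto_ident_at)
      then show "((\<lambda>h::real. h ^ n / h ^ (n - 1)) \<longlongrightarrow> 0) (at 0)"
        by (rule Lim_transform_eventually)
           (rule eventually_mono[OF nz], use d in \<open>simp add: power_diff[symmetric] Suc_diff_Suc\<close>)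
    qed (rule eventually_mono[OF nz], simp)
    then show "(\<lambda>h. g h - A * h ^ n) \<in> o[at 0](\<lambda>h. h ^ (n - 1))"
      by (intro sum_in_smallo small) simp
    show "(\<lambda>h. (g (2 * h) - A * (2 * h) ^ n) - 2 ^ d * (g h - A * h ^ n)) \<in> o[at 0](\<lambda>h. h ^ n)"
    proof (rule smalloI_tendsto)
      have "((\<lambda>h. (g (2 * h) - 2 ^ d * g h) / h ^ n - L) \<longlongrightarrow> L - L) (at 0)"
        by (intro tendsto_intros L)
      then have "((\<lambda>h. (g (2 * h) - 2 ^ d * g h) / h ^ n - A * q) \<longlongrightarrow> 0) (at 0)"
        using q by (simp add: A_def)
      then show "((\<lambda>h. ((g (2 * h) - A * (2 * h) ^ n) - 2 ^ d * (g h - A * h ^ n)) / h ^ n) \<longlongrightarrow> 0) (at 0)"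
        by (rule Lim_transform_eventually)
           (rule eventually_mono[OF nz], use d in \<open>simp add: field_simps q_def\<close>)
    qed (rule eventually_mono[OF nz], simp)
  qed
  then have "((\<lambda>h. (g h - A * h ^ n) / h ^ n) \<longlongrightarrow> 0) (at 0)"
    by (rule smalloD_tendsto)
  then have "((\<lambda>h. (g h - A * h ^ n) / h ^ n + A) \<longlongrightarrow> 0 + A) (at 0)"
    by (intro tendsto_intros)
  then have "((\<lambda>h. g h / h ^ n) \<longlongrightarrow> 0 + A) (at 0)"
    by (rule Lim_transform_eventually)
       (rule eventually_mono[OF nz], use d in \<open>simp add: field_simps\<close>)
  then show ?thesis unfolding has_order_limit_def by blast
qed

section \<open>Propagation from \<open>n\<close> consecutive integers to a longer range\<close>

text \<open>An \<open>n\<close>-th difference involves \<open>n + 1\<close> consecutive indices, and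
  its two extreme coefficients are 1 and \<open>(-1) ^ n\<close>. So \<open>n\<close> known
  neighbours determine the next value on either side. The differences with \<open>k < n\<close>
  reach exactly from \<open>1 - n\<close> to \<open>n\<close>.\<close>

lemma has_order_limit_extend_window:
  fixes r :: "int \<Rightarrow> real \<Rightarrow> real"
  assumes diff: "\<And>k. k < n \<Longrightarrow> has_order_limit n
      (\<lambda>h. \<Sum>j=0..n. (-1) ^ (n - j) * real (n choose j) * r (int j - int k) h)"
    and window: "\<And>i. - int m \<le> i \<Longrightarrow> i < int n - int m \<Longrightarrow> has_order_limit n (r i)"
    and m: "m < n"
    and i: "- int n < i" "i \<le> int n"
  shows "has_order_limit n (r i)"
proof -
  have up: "has_order_limit n (r (int t - int m))" if "int t - int m \<le> int n" for t
    using that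
  proof (induction t rule: less_induct)
    case (less t)
    show ?case
    proof (cases "t < n")
      case True
      then show ?thesis by (intro window) auto
    next
      case False
      \<comment> \<open>This puts the top node \<open>n - k\<close> of the difference at
        \<open>t - m\<close>; all its other nodes lie lower and are covered by induction.\<close>
      define k where "k = n + m - t"
      have k: "k < n" "int n - int k = int t - int m"
        using False less.prems m by (auto simp: k_def)
      have "has_order_limit n (r (int j - int k))" if "j < n" for j
      proof -
        have "int j - int k = int (j + t - n) - int m" "j + t - n < t"
          using k that False by auto
        then show ?thesis using less.IH[of "j + t - n"] less.prems by simp
      qed
      then have "has_order_limit n
          (\<lambda>h. \<Sum>j<n. (-1) ^ (n - j) * real (n choose j) * r (int j - int k) h)"
        by (intro has_order_limit_sum has_order_limit_cmult) auto
      from has_order_limit_diff[OF diff[OF k(1)] this]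
      have "has_order_limit n (r (int n - int k))"
        by (simp add: atLeast0AtMost lessThan_Suc_atMost[symmetric])
      then show ?thesis by (simp add: k)
    qed
  qed
  have down: "has_order_limit n (r (int n - int t))" if "t < 2 * n" for t
    using that
  proof (induction t rule: less_induct)
    case (less t)
    show ?case
    proof (cases "t \<le> n + m")
      case True
      then show ?thesis using up[of "n + m - t"] by simp
    next
      case False
      \<comment> \<open>Now the bottom node \<open>- k\<close> is the new index
        \<open>n - t\<close>, and the nodes above it are already known. Its sign
        \<open>(-1) ^ n\<close> is removed at the end by multiplying with \<open>(-1) ^ n\<close>
        again.\<close>
      define k where "k = t - n"
      have k: "k < n" "int n - int t = - int k"
        using False less.prems by (auto simp: k_def)
      have "has_order_limit n (r (int (Suc j) - int k))" if "j < n" for j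
      proof -
        have "int (Suc j) - int k = int n - int (t - Suc j)" "t - Suc j < t"
          using k that False by auto
        then show ?thesis using less.IH[of "t - Suc j"] less.prems by simp
      qed
      then have "has_order_limit n
          (\<lambda>h. \<Sum>j<n. (-1) ^ (n - Suc j) * real (n choose Suc j) * r (int (Suc j) - int k) h)"
        by (intro has_order_limit_sum has_order_limit_cmult) auto
      from has_order_limit_diff[OF diff[OF k(1)] this]
      have "has_order_limit n (\<lambda>h. (-1) ^ n * r (- int k) h)"
        by (simp add: atLeast0AtMost lessThan_Suc_atMost[symmetric] sum.lessThan_Suc_shift
            del: sum.lessThan_Suc)
      from has_order_limit_cmult[OF this, of "(-1) ^ n"] show ?thesis
        by (simp add: k mult.assoc[symmetric] power_mult_distrib[symmetric])
    qed
  qed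
  show ?thesis
    using down[of "nat (int n - i)"] i by simp
qed

section \<open>The normalized case: interpolating the values \<open>f (i * h)\<close>\<close>

lemma has_order_limit_of_nth_differences:
  fixes f :: "real \<Rightarrow> real"
  assumes n: "n \<ge> 2"
    and zero: "f 0 = 0"
    and small: "f \<in> o[at 0](\<lambda>h. h ^ (n - 1))"
    and diff: "\<And>k. k < n \<Longrightarrow> has_order_limit n
      (\<lambda>h. \<Sum>j=0..n. (-1) ^ (n - j) * real (n choose j) * f ((real j - real k) * h))"
  shows "has_order_limit n f"
proof -
  \<comment> \<open>The window \<open>I\<close> of \<open>n\<close> integers is centred so that
    \<open>2 * j\<close> lies above \<open>- n\<close> and at most at \<open>n\<close> for every
    \<open>j\<close> in \<open>I\<close>. It contains 1 because \<open>n \<ge> 2\<close>.\<close>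
  define m where "m = (n - 1) div 2"
  define I :: "int set" where "I = {- int m ..< int n - int m}"
  define l where "l j = lagrange_basis (real_of_int ` I) (real_of_int j)" for j
  \<comment> \<open>Let P_h be the polynomial of degree below \<open>n\<close> that interpolates
    \<open>f (j * h)\<close> at the nodes \<open>j\<close> in \<open>I\<close>. Then
    \<open>a d h\<close> is its coefficient of x^d, and \<open>r i h\<close> is the interpolation
    error at \<open>i\<close>.\<close>
  define a where "a d h = (\<Sum>j\<in>I. coeff (l j) d * f (real_of_int j * h))" for d h
  define r where "r i h = f (real_of_int i * h) - (\<Sum>j\<in>I. poly (l j) (real_of_int i) * f (real_of_int j * h))" for i :: int and h :: real
  have m: "m < n" using n by (auto simp: m_def)
  have card: "card (real_of_int ` I) = n" "finite (real_of_int ` I)" "finite I"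
    by (simp_all add: I_def card_image inj_on_def)
  have deg: "degree (l j) < n" if "j \<in> I" for j
    using degree_lagrange_basis[of "real_of_int ` I" "real_of_int j"] that card by (simp add: l_def)
  have l: "poly (l j) (real_of_int i) = (if j = i then 1 else 0)" if "i \<in> I" "j \<in> I" for i j
    using poly_lagrange_basis[of "real_of_int ` I"] that card by (auto simp: l_def)
  have poly_l: "poly (l j) x = (\<Sum>d<n. coeff (l j) d * x ^ d)" if "j \<in> I" for j and x :: real
  proof -
    have "poly (\<Sum>d\<le>n - 1. monom (coeff (l j) d) d) x = poly (l j) x"
      using deg[OF that] by (subst poly_as_sum_of_monoms') auto
    moreover have "{..n - 1} = {..<n}" using n by auto
    ultimately show ?thesis by (simp add: poly_sum poly_monom)
  qed
  \<comment> \<open>The coefficients of the Lagrange basis form the inverse of the Vandermonde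
    matrix, because interpolation reproduces the monomial x^e.\<close>
  have dual: "(\<Sum>j\<in>I. coeff (l j) d * real_of_int j ^ e) = (if d = e then 1 else 0)" if "e < n" for d e
  proof -
    have "degree (monom (1::real) e) < card (real_of_int ` I)"
      using that card by (simp add: degree_monom_eq)
    from lagrange_interpolation[OF card(2) this]
    have "(\<Sum>j\<in>I. smult (real_of_int j ^ e) (l j)) = monom 1 e"
      by (simp add: sum.reindex inj_on_def poly_monom l_def)
    then have "coeff (\<Sum>j\<in>I. smult (real_of_int j ^ e) (l j)) d = coeff (monom 1 e) d" by simp
    then show ?thesis by (simp add: coeff_sum mult.commute eq_commute)
  qed
  have r: "has_order_limit n (r i)" if "- int n < i" "i \<le> int n" for i
  proof (rule has_order_limit_extend_window[OF _ _ m that])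
    fix i :: int assume "- int m \<le> i" "i < int n - int m"
    then have i: "i \<in> I" by (simp add: I_def)
    have "r i = (\<lambda>h. 0)"
      using i card by (auto simp: r_def l if_distrib[of "\<lambda>x. x * _"] sum.delta cong: sum.cong if_cong)
    then show "has_order_limit n (r i)" by (simp add: has_order_limit_zero)
  next
    fix k assume k: "k < n"
    \<comment> \<open>P_h has degree below \<open>n\<close>, so \<open>n\<close>-th differences do
      not distinguish \<open>r\<close> from the values of \<open>f\<close>.\<close>
    have "(\<Sum>j=0..n. (-1) ^ (n - j) * real (n choose j) * r (int j - int k) h)
        = (\<Sum>j=0..n. (-1) ^ (n - j) * real (n choose j) * f ((real j - real k) * h))" for h
    proof -
      have "(\<Sum>j=0..n. (-1) ^ (n - j) * real (n choose j)
            * (\<Sum>i\<in>I. poly (l i) (real j - real k) * f (real_of_int i * h)))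
          = (\<Sum>i\<in>I. f (real_of_int i * h) * (\<Sum>j=0..n. (-1) ^ (n - j) * real (n choose j)
            * poly (l i) (- real k + real j)))"
        unfolding sum_distrib_left by (subst sum.swap) (simp add: mult_ac)
      also have "\<dots> = 0"
        using nth_difference_poly_eq_0[OF deg, of _ "- real k"] by (intro sum.neutral) (simp del: add_uminus_conv_diff uminus_add_conv_diff)
      finally show ?thesis
        by (simp add: r_def right_diff_distrib sum_subtractf)
    qed
    then show "has_order_limit n
        (\<lambda>h. \<Sum>j=0..n. (-1) ^ (n - j) * real (n choose j) * r (int j - int k) h)"
      using diff[OF k] by simp
  qed
  have a: "has_order_limit n (a d)" if d: "d < n" for d
  proof (rule has_order_limit_of_half_scaling[OF d])
    have "(\<lambda>h. f (real_of_int j * h)) \<in> o[at 0](\<lambda>h. h ^ (n - 1))" for j :: int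
    \<comment> \<open>For \<open>j = 0\<close> the inner map does not stay away from 0, so
      composition of limits fails; there \<open>f 0 = 0\<close> is used.\<close>
    proof (cases "j = 0")
      case False
      have "filterlim (\<lambda>h. real_of_int j * h) (at 0) (at 0)"
      proof (rule filterlim_atI)
        show "((\<lambda>h. real_of_int j * h) \<longlongrightarrow> 0) (at 0)"
          by (intro tendsto_eq_intros) auto
      qed (use False in \<open>auto simp: eventually_at intro: exI[of _ 1]\<close>)
      from landau_o.small.compose[OF small this]
      have "(\<lambda>h. f (real_of_int j * h)) \<in> o[at 0](\<lambda>h. (real_of_int j * h) ^ (n - 1))" .
      then show ?thesis using False by (simp add: power_mult_distrib)
    qed (simp add: zero)
    then show "a d \<in> o[at 0](\<lambda>h. h ^ (n - 1))"
      unfolding a_def by (intro big_sum_in_smallo) auto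
    have "a d (2 * h) - 2 ^ d * a d h = (\<Sum>j\<in>I. coeff (l j) d * r (2 * j) h)" for h
    proof -
      \<comment> \<open>The sum extracts the coefficient of x^d from the interpolant of P_h(2x).
        That polynomial again has degree below \<open>n\<close>, hence is its own interpolant, and
        the coefficient is \<open>2 ^ d * a d h\<close>.\<close>
      have "(\<Sum>j\<in>I. coeff (l j) d * (\<Sum>i\<in>I. poly (l i) (2 * real_of_int j) * f (real_of_int i * h)))
          = (\<Sum>j\<in>I. coeff (l j) d * (\<Sum>i\<in>I. (\<Sum>e<n. coeff (l i) e * (2 * real_of_int j) ^ e) * f (real_of_int i * h)))"
        by (simp add: poly_l cong: sum.cong)
      also have "\<dots> = (\<Sum>i\<in>I. f (real_of_int i * h) * (\<Sum>e<n. coeff (l i) e * 2 ^ e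
            * (\<Sum>j\<in>I. coeff (l j) d * real_of_int j ^ e)))"
      proof -
        have "(\<Sum>j\<in>I. u j * (\<Sum>i\<in>I. S i j * v i)) = (\<Sum>i\<in>I. v i * (\<Sum>j\<in>I. u j * S i j))"
          for u v :: "int \<Rightarrow> real" and S
          unfolding sum_distrib_left by (subst sum.swap) (simp add: mult_ac)
        moreover have "(\<Sum>j\<in>I. coeff (l j) d * (\<Sum>e<n. coeff (l i) e * (2 * real_of_int j) ^ e))
            = (\<Sum>e<n. coeff (l i) e * 2 ^ e * (\<Sum>j\<in>I. coeff (l j) d * real_of_int j ^ e))" for i
          unfolding sum_distrib_left power_mult_distrib by (subst sum.swap) (simp add: mult_ac)
        ultimately show ?thesis by simp
      qed
      also have "\<dots> = (\<Sum>i\<in>I. f (real_of_int i * h) * (coeff (l i) d * 2 ^ d))"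
      proof -
        have "(\<Sum>e<n. coeff (l i) e * 2 ^ e * (\<Sum>j\<in>I. coeff (l j) d * real_of_int j ^ e))
            = (\<Sum>e<n. if e = d then coeff (l i) d * 2 ^ d else 0)" for i
          by (intro sum.cong refl) (auto simp: dual)
        then show ?thesis using d by simp
      qed
      also have "\<dots> = 2 ^ d * a d h"
        by (simp add: a_def sum_distrib_left mult_ac)
      finally show ?thesis
        by (simp add: a_def r_def right_diff_distrib sum_subtractf mult_ac)
    qed
    moreover have "has_order_limit n (\<lambda>h. \<Sum>j\<in>I. coeff (l j) d * r (2 * j) h)"
      using m by (intro has_order_limit_sum has_order_limit_cmult r) (auto simp: I_def m_def)
    ultimately show "has_order_limit n (\<lambda>h. a d (2 * h) - 2 ^ d * a d h)" by simp
  qed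
  have "f h = (\<Sum>d<n. a d h)" for h
  proof -
    \<comment> \<open>At the node 1 the interpolant P_h takes the value \<open>f h\<close>, and
      P_h(1) is the sum of its coefficients.\<close>
    have one: "1 \<in> I" using n by (auto simp: I_def m_def)
    have "(\<Sum>d<n. a d h) = (\<Sum>j\<in>I. poly (l j) (real_of_int 1) * f (real_of_int j * h))"
      unfolding a_def by (subst sum.swap) (simp add: poly_l sum_distrib_right cong: sum.cong)
    also have "\<dots> = (\<Sum>j\<in>I. if j = 1 then f h else 0)"
      by (intro sum.cong refl) (simp only: l[OF one], simp)
    also have "\<dots> = f h" using one card by simp
    finally show ?thesis by simp
  qed
  moreover have "has_order_limit n (\<lambda>h. \<Sum>d<n. a d h)"
    using a by (intro has_order_limit_sum) auto
  ultimately show ?thesis by presburger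
qed

section \<open>Reduction to the normalized case and the Peano polynomial of order
  \<open>n\<close>\<close>

theorem mainTheorem1:
  fixes n :: nat and c :: real and f :: "real \<Rightarrow> real"
  assumes "n \<ge> 2"
    and "peano_differentiable (n - 1) f c"
    and "\<And>k :: nat. k \<le> n - 1 \<Longrightarrow>
      \<exists>L :: real. ((\<lambda>h. 1 / h ^ n *
        (\<Sum>j = 0..n. (-1) ^ (n - j) * real (n choose j) * f (c + (real j - real k) * h)))
        \<longlongrightarrow> L) (at 0)"
  shows "peano_differentiable n f c"
proof -
  from assms(2) obtain p where p: "degree p \<le> n - 1" "poly p c = f c"
    and small: "(\<lambda>h. f (c + h) - poly p (c + h)) \<in> o[at 0](\<lambda>h. h ^ (n - 1))"
    unfolding peano_differentiable_def by blast
  define g where "g h = f (c + h) - poly p (c + h)" for h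
  have "has_order_limit n g"
  proof (rule has_order_limit_of_nth_differences[OF assms(1)])
    show "g \<in> o[at 0](\<lambda>h. h ^ (n - 1))" using small unfolding g_def .
    fix k assume k: "k < n"
    have "(\<Sum>j=0..n. (-1) ^ (n - j) * real (n choose j) * poly p (c + (real j - real k) * h)) = 0" for h
    proof -
      \<comment> \<open>For fixed \<open>h\<close> the map x to p(c + x h) is a polynomial in x of
        degree below \<open>n\<close>, so its \<open>n\<close>-th difference starting at
        \<open>- k\<close> vanishes.\<close>
      have "degree (pcompose p [:c, h:]) < n"
        using p(1) assms(1) degree_pcompose_le[of p "[:c, h:]"]
        by (auto split: if_splits)
      from nth_difference_poly_eq_0[OF this, of "- real k"] show ?thesis
        by (simp add: poly_pcompose mult.commute)
    qed
    then have "(\<Sum>j=0..n. (-1) ^ (n - j) * real (n choose j) * g ((real j - real k) * h))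
        = (\<Sum>j=0..n. (-1) ^ (n - j) * real (n choose j) * f (c + (real j - real k) * h))" for h
      by (simp add: g_def right_diff_distrib sum_subtractf)
    then show "has_order_limit n
        (\<lambda>h. \<Sum>j=0..n. (-1) ^ (n - j) * real (n choose j) * g ((real j - real k) * h))"
      using assms(3)[of k] k by (simp add: has_order_limit_def)
  qed (simp add: g_def p)
  then obtain A where A: "((\<lambda>h. g h / h ^ n) \<longlongrightarrow> A) (at 0)"
    unfolding has_order_limit_def by blast
  have nz: "eventually (\<lambda>h::real. h \<noteq> 0) (at 0)"
    by (auto simp: eventually_at intro: exI[of _ 1])
  show ?thesis unfolding peano_differentiable_def
  proof (intro exI conjI)
    \<comment> \<open>The limit \<open>A\<close> of \<open>g h / h ^ n\<close> is the missing
      coefficient of order \<open>n\<close> in powers of x - c.\<close>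
    let ?p = "p + smult A ([:- c, 1:] ^ n)"
    show "degree ?p \<le> n"
      using p(1) degree_linear_power[of "- c" n]
      by (intro degree_add_le order.trans[OF degree_smult_le]) auto
    show "poly ?p c = f c" using p assms(1) by simp
    show "(\<lambda>h. f (c + h) - poly ?p (c + h)) \<in> o[at 0](\<lambda>h. h ^ n)"
    proof (rule smalloI_tendsto)
      have "((\<lambda>h. g h / h ^ n - A) \<longlongrightarrow> A - A) (at 0)"
        by (intro tendsto_intros A)
      then have "((\<lambda>h. g h / h ^ n - A) \<longlongrightarrow> 0) (at 0)" by simp
      then show "((\<lambda>h. (f (c + h) - poly ?p (c + h)) / h ^ n) \<longlongrightarrow> 0) (at 0)"
        by (rule Lim_transform_eventually)
           (rule eventually_mono[OF nz], use p in \<open>simp add: field_simps g_def\<close>)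
    qed (rule eventually_mono[OF nz], simp)
  qed
qed

end
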